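(* Let $n\ge 1$ and let $P=\{z_1,\dots,z_n\}\subset\mathbb C$ satisfy $\operatorname{diam}(P)\le 2$ and $\Delta(P)=\Delta_{\max}(n)$. Then the diameter graph of $P$ is either unicyclic or a caterpillar.
   Context: For points $z_1,\dots,z_n\in\mathbb C$, $\Delta(z_1,\dots,z_n)=\prod_{i\neq j}|z_i-z_j|=\prod_{1\le i<j\le n}|z_i-z_j|^2$ (empty product $=1$). $\Delta_{\max}(n)=\sup\{\Delta(z_1,\dots,z_n): \max_{i,j}|z_i-z_j|\le 2\}$ (the supremum is attained). The diameter graph of a finite point set $P$ is the graph with vertex set $P$ in which two points are adjacent iff their distance equals $\operatorname{diam}(P)=\max\{|x-y|:x,y\in P\}$. A caterpillar is a tree such that deleting all leaves leaves a path (possibly empty); a unicyclic graph is a connected graph containing exactly one cycle. *)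

theory Defs
  imports "HOL-Analysis.Analysis" "Graph_Theory.Graph_Theory"
begin

hide_const (open) Digraph_Component.connected Digraph_Component.tree

section \<open>The product of distances\<close>

text \<open>A configuration of \<open>n\<close> points is a function \<open>z\<close> read on the indices \<open>1, \<dots>, n\<close> only.
  The product runs over ordered pairs, so every unordered pair contributes a squared distance.\<close>

definition Delta :: "nat \<Rightarrow> (nat \<Rightarrow> complex) \<Rightarrow> real" where
  "Delta n z = (\<Prod>(i, j) \<in> {(i, j). i \<in> {1..n} \<and> j \<in> {1..n} \<and> i \<noteq> j}. cmod (z i - z j))"

definition Delta_max :: "nat \<Rightarrow> real" where
  "Delta_max n = Sup {Delta n z | z. \<forall>i\<in>{1..n}. \<forall>j\<in>{1..n}. cmod (z i - z j) \<le> 2}"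

text \<open>The supremum is over a nonempty set that is bounded above, so \<open>Sup\<close> on the reals is
  meaningful here.\<close>

lemma Delta_nonempty:
  "{Delta n z | z. \<forall>i\<in>{1..n}. \<forall>j\<in>{1..n}. cmod (z i - z j) \<le> 2} \<noteq> {}"
proof -
  have "Delta n (\<lambda>_. 0) \<in> {Delta n z | z. \<forall>i\<in>{1..n}. \<forall>j\<in>{1..n}. cmod (z i - z j) \<le> 2}"
    by (intro CollectI exI[of _ "\<lambda>_. 0"]) simp
  then show ?thesis by (metis empty_iff)
qed

lemma Delta_bdd_above:
  "bdd_above {Delta n z | z. \<forall>i\<in>{1..n}. \<forall>j\<in>{1..n}. cmod (z i - z j) \<le> 2}"
proof -
  let ?I = "{(i, j). i \<in> {1..n} \<and> j \<in> {1..n} \<and> i \<noteq> j}"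
  have "Delta n z \<le> (\<Prod>p\<in>?I. 2)"
    if "\<forall>i\<in>{1..n}. \<forall>j\<in>{1..n}. cmod (z i - z j) \<le> 2" for z
    unfolding Delta_def by (rule prod_mono) (use that in auto)
  then show ?thesis by (intro bdd_aboveI[of _ "\<Prod>p\<in>?I. 2"]) auto
qed

section \<open>Undirected graphs\<close>

text \<open>A finite simple graph is a \<^locale>\<open>pair_graph\<close>: a finite, loop-free, symmetric digraph without
  parallel arcs, each edge being represented by its two opposite arcs. The notions \<open>cycle\<close>,
  \<open>forest\<close> and \<open>tree\<close> of the digraph library count the closed walk along an edge and
  back as a cycle, and distinguish the starting points and orientations of a cycle. An undirected
  cycle therefore needs length at least \<open>3\<close>, and is identified with its set of edges.\<close>

definition ucycles :: "'a pair_pre_digraph \<Rightarrow> 'a set set set" where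
  "ucycles G = {(\<lambda>(u, v). {u, v}) ` set p | p. pre_digraph.cycle (with_proj G) p \<and> 3 \<le> length p}"

definition unicyclic :: "'a pair_pre_digraph \<Rightarrow> bool" where
  "unicyclic G \<longleftrightarrow> Digraph_Component.connected (with_proj G) \<and> (\<exists>!C. C \<in> ucycles G)"

definition utree :: "'a pair_pre_digraph \<Rightarrow> bool" where
  "utree G \<longleftrightarrow> Digraph_Component.connected (with_proj G) \<and> ucycles G = {}"

text \<open>The empty list gives the empty path, a singleton list the path with one vertex.\<close>

definition is_path_graph :: "('a, 'a \<times> 'a) pre_digraph \<Rightarrow> bool" where
  "is_path_graph H \<longleftrightarrow> (\<exists>vs. distinct vs \<and> verts H = set vs \<and>
     arcs_ends H = set (vwalk_arcs vs) \<union> (set (vwalk_arcs vs))\<inverse>)"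

text \<open>In a symmetric digraph the out-degree is the degree of the undirected graph.\<close>

definition leaves :: "'a pair_pre_digraph \<Rightarrow> 'a set" where
  "leaves G = {v \<in> pverts G. out_degree (with_proj G) v = 1}"

definition caterpillar :: "'a pair_pre_digraph \<Rightarrow> bool" where
  "caterpillar G \<longleftrightarrow>
     utree G \<and> is_path_graph (induce_subgraph (with_proj G) (pverts G - leaves G))"

section \<open>The diameter graph\<close>

text \<open>The condition \<open>x \<noteq> y\<close> only matters for a single point, where the diameter is \<open>0\<close>.\<close>

definition diameter_graph :: "complex set \<Rightarrow> complex pair_pre_digraph" where
  "diameter_graph P =
     \<lparr>pverts = P, parcs = {(x, y). x \<in> P \<and> y \<in> P \<and> x \<noteq> y \<and> dist x y = diameter P}\<rparr>"

lemma pair_graph_diameter_graph: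
  assumes "finite P"
  shows "pair_graph (diameter_graph P)"
proof -
  let ?G = "diameter_graph P"
  show ?thesis
  proof
    show "finite (pverts ?G)" using assms by (simp add: diameter_graph_def)
    show "finite (parcs ?G)"
      by (rule finite_subset[of _ "P \<times> P"]) (use assms in \<open>auto simp: diameter_graph_def\<close>)
    show "symmetric (with_proj ?G)"
      by (auto simp: symmetric_def sym_def diameter_graph_def dist_commute arcs_ends_def arc_to_ends_def)
  qed (auto simp: diameter_graph_def)
qed

end

theory Submission
  imports Defs "HOL-Complex_Analysis.Complex_Analysis"
begin

text \<open>If the diameter graph of a maximiser were disconnected, one part \<open>A\<close> could be translated by
  every small complex \<open>t\<close> without violating the constraint. The product of all differences is a
  polynomial in \<open>t\<close>, nonconstant since it vanishes when a point of \<open>A\<close> hits a point outside, so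
  its modulus has no local maximum at \<open>0\<close>: a contradiction. Moreover, of three diameters at a common
  point the middle one ends in a leaf, so every vertex has at most two neighbours that are not
  leaves. In a connected graph with this property the non-leaves form a cycle or a path.\<close>

section \<open>Extremal configurations and the maximum modulus principle\<close>

lemma Delta_pos_iff: "Delta n z > 0 \<longleftrightarrow> inj_on z {1..n}"
proof -
  have "Delta n z \<ge> 0"
    unfolding Delta_def by (rule prod_nonneg) auto
  moreover have "finite {(i, j). i \<in> {1..n} \<and> j \<in> {1..n} \<and> i \<noteq> j}"
    by (rule finite_subset[of _ "{1..n} \<times> {1..n}"]) auto
  then have "Delta n z = 0 \<longleftrightarrow> \<not> inj_on z {1..n}"
    unfolding Delta_def by (subst prod_zero_iff) (auto simp: inj_on_def Bex_def)
  ultimately show ?thesis by linarith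
qed

lemma Delta_le_Delta_max:
  assumes "\<And>i j. i \<in> {1..n} \<Longrightarrow> j \<in> {1..n} \<Longrightarrow> cmod (z i - z j) \<le> 2"
  shows "Delta n z \<le> Delta_max n"
  unfolding Delta_max_def by (rule cSup_upper[OF _ Delta_bdd_above]) (use assms in auto)

lemma Delta_max_pos: "Delta_max n > 0"
proof -
  \<comment> \<open>Equally spaced points of the interval (0, 1]: distinct, and in the unit disc,
    hence admissible.\<close>
  define z :: "nat \<Rightarrow> complex" where "z i = of_real (real i / real n)" for i
  have "Delta n z > 0"
    unfolding Delta_pos_iff by (auto simp: inj_on_def z_def)
  moreover have "cmod (z i - z j) \<le> 2" if "i \<in> {1..n}" "j \<in> {1..n}" for i j
  proof -
    have "cmod (z i) \<le> 1" "cmod (z j) \<le> 1"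
      using that by (simp_all add: z_def norm_divide)
    then show ?thesis using norm_triangle_ineq4[of "z i" "z j"] by linarith
  qed
  ultimately show ?thesis using Delta_le_Delta_max by (meson less_le_trans)
qed

text \<open>This is connectedness of the diameter graph in the form of cuts: every split of the
  indices is crossed by a pair at distance 2. It also forces the diameter to be exactly 2 as soon as
  there are two points.\<close>

lemma extremal_no_gap:
  fixes z :: "nat \<Rightarrow> complex"
  assumes bound: "\<And>i j. i \<in> {1..n} \<Longrightarrow> j \<in> {1..n} \<Longrightarrow> cmod (z i - z j) \<le> 2"
    and max: "Delta n z = Delta_max n"
    and I: "I \<subseteq> {1..n}" "I \<noteq> {}" "I \<noteq> {1..n}"
  shows "\<exists>i\<in>I. \<exists>j\<in>{1..n} - I. cmod (z i - z j) = 2"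
proof (rule ccontr)
  assume "\<not> ?thesis"
  then have gap: "cmod (z i - z j) < 2" if "i \<in> I" "j \<in> {1..n} - I" for i j
    using that bound[of i j] I by force
  define z' where "z' t i = (if i \<in> I then z i + t else z i)" for t i
  \<comment> \<open>The differences are multiplied without moduli, so that \<open>f\<close> is
    holomorphic in t while its modulus is the \<open>Delta\<close> of the translated
    configuration.\<close>
  define f where "f t = (\<Prod>(i, j) \<in> {(i, j). i \<in> {1..n} \<and> j \<in> {1..n} \<and> i \<noteq> j}. z' t i - z' t j)" for t
  have norm_f: "cmod (f t) = Delta n (z' t)" for t
    unfolding f_def Delta_def by (simp add: prod_norm[symmetric] case_prod_unfold)
  have z'0: "z' 0 = z" by (auto simp: z'_def)
  \<comment> \<open>The strict inequality at each cross pair survives small t, and there are only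
    finitely many pairs.\<close>
  have "eventually (\<lambda>t. \<forall>i\<in>I. \<forall>j\<in>{1..n} - I. cmod (z i + t - z j) < 2) (nhds 0)"
  proof -
    have "eventually (\<lambda>t. cmod (z i + t - z j) < 2) (nhds 0)"
      if "i \<in> I" "j \<in> {1..n} - I" for i j
    proof -
      have "((\<lambda>t. cmod (z i + t - z j)) \<longlongrightarrow> cmod (z i + 0 - z j)) (nhds 0)"
        by (intro tendsto_intros filterlim_ident)
      then show ?thesis using gap[OF that] by (auto dest: order_tendstoD(2))
    qed
    moreover have "finite I" using I finite_subset by blast
    ultimately show ?thesis by (simp add: eventually_ball_finite)
  qed
  then obtain U where U: "open U" "0 \<in> U"
    "\<And>t i j. t \<in> U \<Longrightarrow> i \<in> I \<Longrightarrow> j \<in> {1..n} - I \<Longrightarrow> cmod (z i + t - z j) < 2"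
    unfolding eventually_nhds by blast
  have "cmod (f t) \<le> cmod (f 0)" if "t \<in> U" for t
  proof -
    \<comment> \<open>Only differences between \<open>I\<close> and its complement change under the
      translation, and \<open>U\<close> controls those.\<close>
    have "cmod (z' t i - z' t j) \<le> 2" if ij: "i \<in> {1..n}" "j \<in> {1..n}" for i j
      using ij bound[of i j] U(3)[OF \<open>t \<in> U\<close>, of i j] U(3)[OF \<open>t \<in> U\<close>, of j i]
      by (auto simp: z'_def norm_minus_commute)
    then show ?thesis
      unfolding norm_f z'0 max by (rule Delta_le_Delta_max)
  qed
  moreover have "(\<lambda>t. z' t i) holomorphic_on UNIV" for i
    by (cases "i \<in> I") (auto simp: z'_def intro!: holomorphic_intros)
  then have "f holomorphic_on UNIV"
    unfolding f_def case_prod_unfold by (intro holomorphic_intros)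
  ultimately have "f constant_on UNIV"
    using U by (intro maximum_modulus_principle[of f UNIV U 0]) auto
  then have const: "f t = f 0" for t by (auto simp: constant_on_def)
  obtain i j where ij: "i \<in> I" "j \<in> {1..n} - I" using I by blast
  \<comment> \<open>At t = z j - z i the translated point i lands on z j, so \<open>f\<close> has a
    zero there.\<close>
  have "\<not> inj_on (z' (z j - z i)) {1..n}"
  proof
    assume "inj_on (z' (z j - z i)) {1..n}"
    then have "i = j" by (rule inj_onD) (use ij I in \<open>auto simp: z'_def\<close>)
    then show False using ij by auto
  qed
  then have "\<not> cmod (f (z j - z i)) > 0"
    unfolding norm_f Delta_pos_iff .
  moreover have "cmod (f 0) > 0"
    unfolding norm_f z'0 max by (rule Delta_max_pos)
  ultimately show False using const by metis
qed

section \<open>Planar geometry: the middle one of three diameters at a point\<close>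

text \<open>As \<open>b\<close> lies on the arc from \<open>a\<close> to \<open>c\<close>, beyond the chord, \<open>s + t > 1\<close>. But the conditions on
  \<open>w\<close> give \<open>|w|\<^sup>2 = 2 w \<bullet> b = s (2 w \<bullet> a) + t (2 w \<bullet> c) \<ge> (s + t) |w|\<^sup>2\<close>.\<close>

lemma middle_neighbour_leaf:
  fixes a b c w :: complex
  assumes "norm a = d" "norm b = d" "norm c = d" "a \<noteq> c"
    and b: "b = s *\<^sub>R a + t *\<^sub>R c" "s > 0" "t > 0"
    and w: "norm (w - b) = d" "norm (w - a) \<le> d" "norm (w - c) \<le> d"
  shows "w = 0"
proof (rule ccontr)
  assume "w \<noteq> 0"
  have "d > 0" using assms by (metis norm_le_zero_iff not_less)
  have sq: "x \<bullet> x = d\<^sup>2" if "norm x = d" for x :: complex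
    using that by (simp add: dot_square_norm)
  \<comment> \<open>The bound |w - x| \<le> d = |x|, squared and expanded. For x = b it becomes an
    equality.\<close>
  have "w \<bullet> w \<le> 2 * (w \<bullet> x)" if "norm x = d" "norm (w - x) \<le> d" for x
  proof -
    have "(w - x) \<bullet> (w - x) \<le> d\<^sup>2"
      using that by (simp add: dot_square_norm power_mono)
    then show ?thesis using sq[OF that(1)]
      by (simp add: inner_diff_left inner_diff_right inner_commute)
  qed
  then have wa: "w \<bullet> w \<le> 2 * (w \<bullet> a)" and wc: "w \<bullet> w \<le> 2 * (w \<bullet> c)"
    using assms by auto
  have "(w - b) \<bullet> (w - b) = d\<^sup>2" using w(1) by (rule sq)
  then have wb: "w \<bullet> w = 2 * (w \<bullet> b)" using sq[of b] assms
    by (simp add: inner_diff_left inner_diff_right inner_commute)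
  \<comment> \<open>Strictness comes from a \<noteq> c and is what puts b beyond the chord:
    replacing a \<bullet> c by d^2 in the expansion of |b|^2 = d^2 gives 1 < (s + t)^2.\<close>
  have "a \<bullet> c < d\<^sup>2"
  proof -
    have "0 < (a - c) \<bullet> (a - c)" using \<open>a \<noteq> c\<close> by simp
    then show ?thesis using sq[of a] sq[of c] assms
      by (simp add: inner_diff_left inner_diff_right inner_commute)
  qed
  have "d\<^sup>2 = s\<^sup>2 * d\<^sup>2 + t\<^sup>2 * d\<^sup>2 + 2 * (s * t) * (a \<bullet> c)"
    using sq[of b] sq[of a] sq[of c] assms
    by (simp add: inner_add_left inner_add_right inner_commute power2_eq_square algebra_simps)
  also have "\<dots> < s\<^sup>2 * d\<^sup>2 + t\<^sup>2 * d\<^sup>2 + 2 * (s * t) * d\<^sup>2"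
    using \<open>a \<bullet> c < d\<^sup>2\<close> b by simp
  also have "\<dots> = (s + t)\<^sup>2 * d\<^sup>2" by (simp add: power2_eq_square algebra_simps)
  finally have "1\<^sup>2 < (s + t)\<^sup>2" using \<open>d > 0\<close> by simp
  then have "1 < s + t" by (rule power_less_imp_less_base) (use b in simp)
  have "w \<bullet> w = s * (2 * (w \<bullet> a)) + t * (2 * (w \<bullet> c))"
    using wb b by (simp add: inner_add_right algebra_simps)
  moreover have "s * (2 * (w \<bullet> a)) \<ge> s * (w \<bullet> w)" "t * (2 * (w \<bullet> c)) \<ge> t * (w \<bullet> w)"
    using wa wc b by simp_all
  ultimately have "w \<bullet> w \<ge> (s + t) * (w \<bullet> w)" by (simp add: algebra_simps)
  moreover have "w \<bullet> w > 0" using \<open>w \<noteq> 0\<close> by simp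
  ultimately show False using \<open>1 < s + t\<close> by simp
qed


text \<open>Vectors of length d at distance at most d enclose an angle of at most 60 degrees, so all
  inner products are positive. A linear relation between a, b, c then cannot have three coefficients
  of the same sign. One coefficient differs in sign from the other two, and solving for its vector
  exhibits that vector as the middle one.\<close>

lemma one_of_three_is_middle:
  fixes a b c :: complex
  assumes norm: "norm a = d" "norm b = d" "norm c = d"
    and distinct: "a \<noteq> b" "b \<noteq> c" "a \<noteq> c"
    and close: "norm (a - b) \<le> d" "norm (b - c) \<le> d" "norm (a - c) \<le> d"
  obtains s t where "s > 0" "t > 0" "a = s *\<^sub>R b + t *\<^sub>R c"
  | s t where "s > 0" "t > 0" "b = s *\<^sub>R a + t *\<^sub>R c"
  | s t where "s > 0" "t > 0" "c = s *\<^sub>R a + t *\<^sub>R b"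
proof -
  \<comment> \<open>The determinant of two plane vectors.\<close>
  define cr where "cr x y = Re x * Im y - Im x * Re y" for x y :: complex
  have "d > 0" using norm distinct by (metis norm_eq_zero norm_ge_zero order_le_less)
  have sq: "x \<bullet> x = d\<^sup>2" if "norm x = d" for x :: complex
    using that by (simp add: dot_square_norm)
  have pos: "x \<bullet> y > 0" if "norm x = d" "norm y = d" "norm (x - y) \<le> d" for x y :: complex
  proof -
    have "(x - y) \<bullet> (x - y) \<le> d\<^sup>2"
      using that by (simp add: dot_square_norm power_mono)
    then have "d\<^sup>2 \<le> 2 * (x \<bullet> y)" using sq[of x] sq[of y] that
      by (simp add: inner_diff_left inner_diff_right inner_commute)
    then show ?thesis using \<open>d > 0\<close> by (smt (verit) zero_less_power)
  qed
  \<comment> \<open>By Lagrange's identity a vanishing determinant leaves only x \<bullet> y = d^2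
    or -d^2. The positive inner product excludes antipodal vectors, so x = y.\<close>
  have nz: "cr x y \<noteq> 0" if "norm x = d" "norm y = d" "norm (x - y) \<le> d" "x \<noteq> y" for x y
  proof
    assume "cr x y = 0"
    have "(x \<bullet> y)\<^sup>2 + (cr x y)\<^sup>2 = (x \<bullet> x) * (y \<bullet> y)"
      by (simp add: cr_def inner_complex_def power2_eq_square algebra_simps)
    then have "(x \<bullet> y)\<^sup>2 = (d\<^sup>2)\<^sup>2"
      using \<open>cr x y = 0\<close> sq that by (simp add: power2_eq_square)
    then have "x \<bullet> y = d\<^sup>2"
      using pos[OF that(1-3)] by (subst (asm) power2_eq_iff_nonneg) auto
    then have "(x - y) \<bullet> (x - y) = 0" using sq[of x] sq[of y] that
      by (simp add: inner_diff_left inner_diff_right inner_commute)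
    then show False using \<open>x \<noteq> y\<close> by simp
  qed
  define \<alpha> \<beta> \<gamma> where "\<alpha> = cr b c" and "\<beta> = cr c a" and "\<gamma> = cr a b"
  have nz': "\<alpha> \<noteq> 0" "\<beta> \<noteq> 0" "\<gamma> \<noteq> 0"
    using nz norm distinct close by (auto simp: \<alpha>_def \<beta>_def \<gamma>_def norm_minus_commute)
  \<comment> \<open>Cramer's rule, an identity for any three vectors of the plane.\<close>
  have rel: "\<alpha> *\<^sub>R a + \<beta> *\<^sub>R b + \<gamma> *\<^sub>R c = 0"
    by (simp add: complex_eq_iff \<alpha>_def \<beta>_def \<gamma>_def cr_def algebra_simps)
  have middle: "x = (- \<mu> / \<kappa>) *\<^sub>R y + (- \<nu> / \<kappa>) *\<^sub>R w"
    if "\<kappa> *\<^sub>R x + \<mu> *\<^sub>R y + \<nu> *\<^sub>R w = 0" "\<kappa> \<noteq> 0" for x y w :: complex and \<kappa> \<mu> \<nu> :: real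
    using that by (simp add: complex_eq_iff field_simps)
  have "\<alpha> * d\<^sup>2 + \<beta> * (a \<bullet> b) + \<gamma> * (a \<bullet> c) = 0"
  proof -
    have "a \<bullet> (\<alpha> *\<^sub>R a + \<beta> *\<^sub>R b + \<gamma> *\<^sub>R c) = 0" by (simp only: rel inner_zero_right)
    then show ?thesis using sq[of a] norm by (simp add: inner_add_right)
  qed
  moreover have "d\<^sup>2 > 0" "a \<bullet> b > 0" "a \<bullet> c > 0"
    using \<open>d > 0\<close> pos norm close by auto
  \<comment> \<open>The inner product of the relation with a combines \<alpha>, \<beta>, \<gamma>
    with positive weights to 0.\<close>
  ultimately have "\<not> (\<alpha> > 0 \<and> \<beta> > 0 \<and> \<gamma> > 0)" "\<not> (\<alpha> < 0 \<and> \<beta> < 0 \<and> \<gamma> < 0)"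
    by (smt (verit) mult_pos_pos mult_neg_pos)+
  then consider
      "- \<beta> / \<alpha> > 0" "- \<gamma> / \<alpha> > 0" | "- \<alpha> / \<beta> > 0" "- \<gamma> / \<beta> > 0" | "- \<alpha> / \<gamma> > 0" "- \<beta> / \<gamma> > 0"
    using nz' by (smt (verit) divide_pos_pos divide_neg_neg)
  then show thesis
  proof cases
    case 1
    then show ?thesis by (rule that(1)) (rule middle, use rel nz' in auto)
  next
    case 2
    then show ?thesis by (rule that(2)) (rule middle, use rel nz' in \<open>auto simp: add_ac\<close>)
  next
    case 3
    then show ?thesis by (rule that(3)) (rule middle, use rel nz' in \<open>auto simp: add_ac\<close>)
  qed
qed

text \<open>After moving v to the origin, the middle one of a, b, c serves as x. The point w is
  compared with a, b, c only, so the lemma applies to any point set of diameter d containing v, a,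
  b, c.\<close>

lemma one_of_three_neighbours_leaf:
  fixes v a b c :: complex
  assumes nbr: "dist v a = d" "dist v b = d" "dist v c = d"
    and distinct: "a \<noteq> b" "b \<noteq> c" "a \<noteq> c"
    and close: "dist a b \<le> d" "dist b c \<le> d" "dist a c \<le> d"
  shows "\<exists>x\<in>{a, b, c}. \<forall>w. dist x w = d \<and> (\<forall>y\<in>{a, b, c}. dist y w \<le> d) \<longrightarrow> w = v"
proof -
  have nbr': "norm (a - v) = d" "norm (b - v) = d" "norm (c - v) = d"
    using nbr by (auto simp: dist_norm norm_minus_commute)
  \<comment> \<open>Here y is the middle vector; the three cases below are permutations of this
    one.\<close>
  have leaf: "\<forall>w. dist y w = d \<and> dist x w \<le> d \<and> dist u w \<le> d \<longrightarrow> w = v"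
    if "norm (x - v) = d" "norm (y - v) = d" "norm (u - v) = d" "x \<noteq> u"
      "s > 0" "t > 0" "y - v = s *\<^sub>R (x - v) + t *\<^sub>R (u - v)" for x y u s t
  proof (intro allI impI)
    fix w assume "dist y w = d \<and> dist x w \<le> d \<and> dist u w \<le> d"
    then have "norm (w - v - (y - v)) = d" "norm (w - v - (x - v)) \<le> d" "norm (w - v - (u - v)) \<le> d"
      by (auto simp: dist_norm norm_minus_commute)
    then have "w - v = 0"
      using that(4) by (intro middle_neighbour_leaf[OF that(1-3) _ that(7,5,6)]) auto
    then show "w = v" by simp
  qed
  from nbr' show ?thesis
  proof (rule one_of_three_is_middle)
    show "a - v \<noteq> b - v" "b - v \<noteq> c - v" "a - v \<noteq> c - v" using distinct by auto
    show "norm (a - v - (b - v)) \<le> d" "norm (b - v - (c - v)) \<le> d" "norm (a - v - (c - v)) \<le> d"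
      using close by (auto simp: dist_norm)
  next
    fix s t :: real assume "s > 0" "t > 0" "a - v = s *\<^sub>R (b - v) + t *\<^sub>R (c - v)"
    from leaf[OF nbr'(2,1,3) distinct(2) this] show ?thesis by blast
  next
    fix s t :: real assume "s > 0" "t > 0" "b - v = s *\<^sub>R (a - v) + t *\<^sub>R (c - v)"
    from leaf[OF nbr'(1,2,3) distinct(3) this] show ?thesis by blast
  next
    fix s t :: real assume "s > 0" "t > 0" "c - v = s *\<^sub>R (a - v) + t *\<^sub>R (b - v)"
    from leaf[OF nbr'(1,3,2) distinct(1) this] show ?thesis by blast
  qed
qed

section \<open>Connectedness and leaves\<close>

text \<open>The set of vertices reachable from a fixed one is closed under adjacency, and
  reachability never leaves a closed set. This form matches the cuts of
  \<open>extremal_no_gap\<close> and also serves to show that a cycle or path exhausts the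
  non-leaves.\<close>

lemma (in pair_sym_digraph) connected_iff_closed:
  "Digraph_Component.connected (with_proj G) \<longleftrightarrow>
    pverts G \<noteq> {} \<and> (\<forall>S\<subseteq>pverts G. S \<noteq> {} \<longrightarrow> (\<forall>(u, v)\<in>parcs G. u \<in> S \<longrightarrow> v \<in> S) \<longrightarrow> S = pverts G)"
    (is "?L \<longleftrightarrow> ?R")
proof
  assume ?L
  then have "strongly_connected (with_proj G)"
    using pair_sym_arcs symmetric_connected_imp_strongly_connected by blast
  then have reach: "u \<rightarrow>\<^sup>*\<^bsub>with_proj G\<^esub> v" if "u \<in> pverts G" "v \<in> pverts G" for u v
    using that by (auto simp: strongly_connected_def)
  have "S = pverts G"
    if S: "S \<subseteq> pverts G" "S \<noteq> {}" "\<forall>(u, v)\<in>parcs G. u \<in> S \<longrightarrow> v \<in> S" for S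
  proof -
    obtain u where u: "u \<in> S" using S by blast
    have "v \<in> S" if "v \<in> pverts G" for v
    proof -
      have "u \<rightarrow>\<^sup>*\<^bsub>with_proj G\<^esub> v" using reach that u S by blast
      then show ?thesis using u S by (induct rule: reachable_induct) auto
    qed
    then show ?thesis using S by blast
  qed
  moreover have "pverts G \<noteq> {}"
    using \<open>?L\<close> by (auto simp: connected_conv)
  ultimately show ?R by blast
next
  assume R: ?R
  show ?L
  proof (rule connectedI)
    show "pverts G \<noteq> {}" using R by blast
    fix u v assume uv: "u \<in> pverts G" "v \<in> pverts G"
    define S where "S = {w. u \<rightarrow>\<^sup>*\<^bsub>with_proj G\<^esub> w}"
    have "S = pverts G"
    proof -
      have "S \<subseteq> pverts G" by (auto simp: S_def dest: reachable_in_verts)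
      moreover have "S \<noteq> {}" using uv by (auto simp: S_def)
      moreover have "\<forall>(a, b)\<in>parcs G. a \<in> S \<longrightarrow> b \<in> S"
        unfolding S_def by (auto intro: reachable_adj_trans)
      ultimately show ?thesis using R by blast
    qed
    then have "u \<rightarrow>\<^sup>*\<^bsub>with_proj G\<^esub> v" using uv by (auto simp: S_def)
    then show "u \<rightarrow>\<^sup>*\<^bsub>with_proj (mk_symmetric (with_proj G))\<^esub> v"
      by (rule reachable_mk_symmetricI)
  qed
qed

lemma leaves_conv:
  "leaves G = {v \<in> pverts G. \<exists>!w. (v, w) \<in> parcs G}"
proof -
  have "out_degree (with_proj G) v = 1 \<longleftrightarrow> (\<exists>!w. (v, w) \<in> parcs G)" for v
  proof -
    have "out_arcs (with_proj G) v = Pair v ` {w. (v, w) \<in> parcs G}"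
      by (auto simp: out_arcs_def)
    then have "out_degree (with_proj G) v = card {w. (v, w) \<in> parcs G}"
      by (simp add: out_degree_def card_image inj_on_def)
    also have "\<dots> = 1 \<longleftrightarrow> (\<exists>w. {w. (v, w) \<in> parcs G} = {w})"
      by (simp add: card_1_singleton_iff)
    also have "\<dots> \<longleftrightarrow> (\<exists>!w. (v, w) \<in> parcs G)"
      by (simp add: set_eq_iff) metis
    finally show ?thesis .
  qed
  then show ?thesis by (simp add: leaves_def)
qed

text \<open>The non-leaves of a connected graph are still connected, since no path can pass through
  a leaf: adding to \<open>H\<close> the leaves attached to it yields a set closed under adjacency,
  hence everything.\<close>

lemma (in pair_sym_digraph) inner_verts_closed_eq:
  assumes con: "Digraph_Component.connected (with_proj G)"
    and H: "H \<subseteq> pverts G - leaves G" "H \<noteq> {}"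
    and closed: "\<And>u v. u \<in> H \<Longrightarrow> (u, v) \<in> parcs G \<Longrightarrow> v \<notin> leaves G \<Longrightarrow> v \<in> H"
  shows "H = pverts G - leaves G"
proof -
  define S where "S = H \<union> {v \<in> leaves G. \<exists>u\<in>H. (u, v) \<in> parcs G}"
  have "S = pverts G"
  proof -
    have "S \<subseteq> pverts G" "S \<noteq> {}"
      using H by (auto simp: S_def leaves_def)
    moreover have "v \<in> S" if uv: "(u, v) \<in> parcs G" "u \<in> S" for u v
    proof (cases "u \<in> H")
      case True
      then show ?thesis using uv closed by (auto simp: S_def)
    next
      case False
      then obtain w where w: "u \<in> leaves G" "w \<in> H" "(w, u) \<in> parcs G"
        using uv by (auto simp: S_def)
      then have "v = w" using uv arcs_symmetric[of w u] by (auto simp: leaves_conv)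
      then show ?thesis using w by (simp add: S_def)
    qed
    ultimately show ?thesis using con unfolding connected_iff_closed by blast
  qed
  then show ?thesis using H by (auto simp: S_def)
qed

section \<open>Cycles and paths as lists of arcs\<close>

lemma pcas_nth:
  assumes "pcas u p v" "Suc i < length p"
  shows "snd (p ! i) = fst (p ! Suc i)"
  using assms
proof (induct p arbitrary: u i)
  case (Cons e p)
  then show ?case by (cases i; cases p) auto
qed simp

lemma pcas_ends:
  assumes "pcas u p v" "p \<noteq> []"
  shows "fst (hd p) = u" "snd (last p) = v"
  using assms by (induct p arbitrary: u) auto

text \<open>The definition of \<open>cycle\<close> demands distinctness of exactly this list, so the
  arcs of a cycle have distinct heads.\<close>

lemma tl_pawalk_verts: "pcas u p v \<Longrightarrow> tl (pawalk_verts u p) = map snd p"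
proof (induct p arbitrary: u)
  case (Cons e p)
  then show ?case by (cases p) auto
qed simp

text \<open>The arc before e ends in \<open>fst e\<close> and the arc after e ends in w. With at
  least three arcs these are different arcs, and distinct arcs of a cycle have distinct
  heads.\<close>

lemma (in pair_wf_digraph) cycle_neighbours:
  assumes "cycle p" "3 \<le> length p" "e \<in> set p"
  shows "fst e \<in> snd ` set p \<and> (\<exists>w. w \<noteq> fst e \<and> (snd e, w) \<in> set p)"
proof -
  obtain v where v: "awalk v p v" "distinct (tl (pawalk_verts v p))" "p \<noteq> []"
    using assms(1) unfolding cycle_def by blast
  then have cas: "pcas v p v" by (simp add: awalk_def)
  then have dist: "distinct (map snd p)" using v by (simp add: tl_pawalk_verts)
  define k where "k = length p"
  have k: "k \<ge> 3" using assms by (simp add: k_def)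
  have step: "fst (p ! (Suc i mod k)) = snd (p ! i)" if "i < k" for i
  proof (cases "Suc i < k")
    case True
    then show ?thesis using pcas_nth[OF cas] by (simp add: k_def)
  next
    case False
    then have "Suc i mod k = 0" "i = length p - 1" using that by (auto simp: k_def mod_Suc)
    moreover have "fst (p ! 0) = v" "snd (p ! (length p - 1)) = v"
      using pcas_ends[OF cas \<open>p \<noteq> []\<close>] \<open>p \<noteq> []\<close> by (auto simp: hd_conv_nth last_conv_nth)
    ultimately show ?thesis by (simp only:)
  qed
  obtain i where i: "i < k" "e = p ! i" using assms(3) by (auto simp: in_set_conv_nth k_def)
  define j where "j = Suc i mod k"
  define l where "l = (if i = 0 then k - 1 else i - 1)"
  \<comment> \<open>The cyclic successor j and predecessor l of i differ because k \<ge> 3.\<close>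
  have jl: "j < k" "l < k" "Suc l mod k = i" "j \<noteq> l"
    using i k by (auto simp: j_def l_def mod_Suc)
  have "snd (p ! j) \<noteq> snd (p ! l)"
    using dist jl by (simp add: distinct_conv_nth k_def)
  moreover have "fst e = snd (p ! l)" using step[of l] jl i by simp
  moreover have "p ! j = (snd e, snd (p ! j))" using step[of i] i by (simp add: prod_eq_iff j_def)
  moreover have "p ! l \<in> set p" "p ! j \<in> set p" using jl by (auto simp: k_def)
  ultimately show ?thesis by (metis imageI)
qed

lemma pcas_vwalk_arcs: "vs \<noteq> [] \<Longrightarrow> pcas (hd vs) (vwalk_arcs vs) (last vs)"
  by (induct vs rule: vwalk_arcs.induct) auto

lemma map_snd_vwalk_arcs: "map snd (vwalk_arcs vs) = tl vs"
  by (induct vs rule: vwalk_arcs.induct) auto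

lemma pcas_snoc: "pcas u (p @ [e]) v \<longleftrightarrow> pcas u p (fst e) \<and> snd e = v"
  by (induct p arbitrary: u) auto

lemma (in pair_wf_digraph) cycle_of_vpath:
  assumes "distinct vs" "vs \<noteq> []" "set (vwalk_arcs vs) \<subseteq> parcs G" "(last vs, hd vs) \<in> parcs G"
  shows "cycle (vwalk_arcs vs @ [(last vs, hd vs)])"
proof -
  let ?p = "vwalk_arcs vs @ [(last vs, hd vs)]"
  have cas: "pcas (hd vs) ?p (hd vs)"
    using pcas_vwalk_arcs[OF assms(2)] by (simp only: pcas_snoc fst_conv snd_conv)
  then have "awalk (hd vs) ?p (hd vs)"
    using assms by (auto simp: awalk_def intro: in_arcsD2)
  moreover have "distinct (tl (pawalk_verts (hd vs) ?p))"
    unfolding tl_pawalk_verts[OF cas] map_append map_snd_vwalk_arcs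
    using assms by (cases vs) auto
  ultimately show ?thesis unfolding cycle_def by blast
qed

lemma set_vwalk_arcs_rev: "set (vwalk_arcs (rev vs)) = (set (vwalk_arcs vs))\<inverse>"
proof (induct vs rule: vwalk_arcs.induct)
  case (3 x y xs)
  then show ?case using vwalk_arcs_append[of "rev (y # xs)" "[x]"] by auto
qed auto


section \<open>The non-leaves form a cycle or a path\<close>

text \<open>Each vertex of a cycle has two non-leaf neighbours on the cycle and so, by
  \<open>two\<close>, no others. The cycle is thus closed under passing to non-leaf neighbours and
  absorbs all non-leaves with all edges between them. Since the right-hand side does not depend on
  \<open>C\<close>, there is at most one cycle.\<close>

lemma (in pair_sym_digraph) ucycle_eq_inner_edges:
  assumes con: "Digraph_Component.connected (with_proj G)"
    and two: "\<And>v a b c. (v, a) \<in> parcs G \<Longrightarrow> (v, b) \<in> parcs G \<Longrightarrow> (v, c) \<in> parcs G \<Longrightarrow>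
      a \<notin> leaves G \<Longrightarrow> b \<notin> leaves G \<Longrightarrow> c \<notin> leaves G \<Longrightarrow> a = b \<or> b = c \<or> a = c"
    and C: "C \<in> ucycles G"
  shows "C = (\<lambda>(u, v). {u, v}) ` {(u, v) \<in> parcs G. u \<notin> leaves G \<and> v \<notin> leaves G}"
proof -
  obtain p where p: "cycle p" "3 \<le> length p" and C_def: "C = (\<lambda>(u, v). {u, v}) ` set p"
    using C by (auto simp: ucycles_def)
  then have sub: "set p \<subseteq> parcs G" "p \<noteq> []" by (auto simp: cycle_def awalk_def)
  define H where "H = snd ` set p"
  have H: "\<exists>u\<in>H. \<exists>w\<in>H. u \<noteq> w \<and> (u, v) \<in> set p \<and> (v, w) \<in> set p" if "v \<in> H" for v
  proof -
    obtain e where e: "e \<in> set p" "v = snd e" using \<open>v \<in> H\<close> by (auto simp: H_def)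
    then obtain w where w: "w \<noteq> fst e" "(v, w) \<in> set p" "fst e \<in> H"
      using cycle_neighbours[OF p e(1)] by (auto simp: H_def)
    have "w \<in> H" using w by (force simp: H_def)
    then show ?thesis using w e by (metis prod.collapse)
  qed
  have inner: "v \<notin> leaves G" if "v \<in> H" for v
    using H[OF that] sub arcs_symmetric by (fastforce simp: leaves_conv)
  have step: "v \<in> H \<and> {u, v} \<in> C" if "u \<in> H" "(u, v) \<in> parcs G" "v \<notin> leaves G" for u v
  proof -
    obtain x y where xy: "x \<in> H" "y \<in> H" "x \<noteq> y" "(x, u) \<in> set p" "(u, y) \<in> set p"
      using H[OF \<open>u \<in> H\<close>] by blast
    then have "v = x \<or> v = y"
      using two[of u x y v] that inner sub arcs_symmetric by blast
    moreover have "{u, x} \<in> C" "{u, y} \<in> C"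
      using xy unfolding C_def by (force simp: insert_commute)+
    ultimately show ?thesis using xy by blast
  qed
  have H_eq: "H = pverts G - leaves G"
  proof (rule inner_verts_closed_eq[OF con])
    show "H \<subseteq> pverts G - leaves G"
      using inner H sub in_arcsD2 by blast
    show "H \<noteq> {}" using sub by (simp add: H_def)
  qed (use step in blast)
  then show ?thesis
  proof (intro equalityI subsetI)
    fix E assume "E \<in> C"
    then obtain e where "e \<in> set p" "E = {fst e, snd e}" by (auto simp: C_def)
    moreover from this have "fst e \<in> H" "snd e \<in> H"
      using cycle_neighbours[OF p, of e] by (auto simp: H_def)
    ultimately show "E \<in> (\<lambda>(u, v). {u, v}) ` {(u, v) \<in> parcs G. u \<notin> leaves G \<and> v \<notin> leaves G}"
      using inner sub by (intro image_eqI[of _ _ e]) (auto simp: case_prod_unfold)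
  next
    fix E assume "E \<in> (\<lambda>(u, v). {u, v}) ` {(u, v) \<in> parcs G. u \<notin> leaves G \<and> v \<notin> leaves G}"
    then obtain u v where "E = {u, v}" "(u, v) \<in> parcs G" "u \<notin> leaves G" "v \<notin> leaves G"
      by auto
    moreover from this have "u \<in> H" using H_eq in_arcsD1 by auto
    ultimately show "E \<in> C" using step by blast
  qed
qed

text \<open>A neighbour of the first vertex v off the path would extend the path, and one beyond the
  second vertex would close a cycle.\<close>

lemma (in pair_graph) maximal_vpath_hd_neighbour:
  assumes acyclic: "ucycles G = {}"
    and vs: "distinct (v # vs)" "set (vwalk_arcs (v # vs)) \<subseteq> parcs G"
    and max: "\<not> (distinct (w # v # vs) \<and> set (vwalk_arcs (w # v # vs)) \<subseteq> parcs G)"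
    and w: "(v, w) \<in> parcs G"
  shows "\<exists>ys. vs = w # ys"
proof -
  have "w \<noteq> v" using w no_loops' by blast
  moreover have "(w, v) \<in> parcs G" using w arcs_symmetric by blast
  ultimately have "w \<in> set vs" using vs max by auto
  then obtain xs ys where xs: "vs = xs @ w # ys" by (auto simp: in_set_conv_decomp)
  have "xs = []"
  proof (rule ccontr)
    assume "xs \<noteq> []"
    \<comment> \<open>The segment from v to w. As \<open>xs\<close> is nonempty it has at least
      three vertices, so closing it gives an undirected cycle and not an edge walked back and
      forth.\<close>
    let ?c = "v # xs @ [w]"
    let ?p = "vwalk_arcs ?c @ [(last ?c, hd ?c)]"
    have "set (vwalk_arcs ?c) \<subseteq> parcs G"
    proof -
      have "set (vwalk_arcs ?c) \<subseteq> set (vwalk_arcs (?c @ ys))"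
        by (rule set_vwalk_arcs_append1)
      also have "?c @ ys = v # vs" by (simp add: xs)
      finally show ?thesis using vs(2) by blast
    qed
    then have "cycle ?p"
      using vs \<open>(w, v) \<in> parcs G\<close> by (intro cycle_of_vpath) (auto simp: xs)
    moreover have "length (vwalk_arcs ?c) = length ?c - 1"
      using vwalk_length_simp[of ?c] by (simp only: vwalk_length_def)
    then have "3 \<le> length ?p" using \<open>xs \<noteq> []\<close> by (cases xs) auto
    ultimately show False using acyclic unfolding ucycles_def by blast
  qed
  then show ?thesis using xs by simp
qed

text \<open>A longest path among the non-leaves has no non-leaf neighbours except along itself: an
  end vertex by acyclicity and maximality, an interior vertex by \<open>two\<close>. So it contains
  all non-leaves and all edges between them.\<close>

lemma (in pair_graph) inner_path_graph:
  assumes con: "Digraph_Component.connected (with_proj G)"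
    and two: "\<And>v a b c. (v, a) \<in> parcs G \<Longrightarrow> (v, b) \<in> parcs G \<Longrightarrow> (v, c) \<in> parcs G \<Longrightarrow>
      a \<notin> leaves G \<Longrightarrow> b \<notin> leaves G \<Longrightarrow> c \<notin> leaves G \<Longrightarrow> a = b \<or> b = c \<or> a = c"
    and acyclic: "ucycles G = {}"
  shows "is_path_graph (induce_subgraph (with_proj G) (pverts G - leaves G))"
proof -
  let ?N = "pverts G - leaves G"
  define Q where "Q vs \<longleftrightarrow> distinct vs \<and> set vs \<subseteq> ?N \<and> set (vwalk_arcs vs) \<subseteq> parcs G" for vs
  have "length vs \<le> card (pverts G)" if "Q vs" for vs
    using that pair_finite_verts card_mono[of "pverts G" "set vs"]
    by (auto simp: Q_def distinct_card)
  moreover have "Q []" by (simp add: Q_def)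
  ultimately obtain vs where vs: "Q vs" and max: "\<And>us. Q us \<Longrightarrow> length us \<le> length vs"
    using ex_has_greatest_nat[of Q "[]" length "Suc (card (pverts G))"]
    by (auto simp: less_Suc_eq_le)
  let ?E = "set (vwalk_arcs vs) \<union> (set (vwalk_arcs vs))\<inverse>"
  have step: "(v, w) \<in> ?E" if v: "v \<in> set vs" and w: "(v, w) \<in> parcs G" "w \<notin> leaves G" for v w
  proof -
    have wN: "w \<in> ?N" using w in_arcsD2 by blast
    have hd: "(v, w) \<in> set (vwalk_arcs us)"
      if us: "us = v # zs" "Q us" "length us = length vs" for us zs
    proof -
      have "\<not> Q (w # us)" using max[of "w # us"] us by auto
      then have "\<exists>ys. zs = w # ys"
        using us w wN by (intro maximal_vpath_hd_neighbour[OF acyclic, of v zs w]) (auto simp: Q_def)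
      then show ?thesis using us by auto
    qed
    obtain xs ys where xy: "vs = xs @ v # ys" using v by (auto simp: in_set_conv_decomp)
    consider "xs = []" | "ys = []" | "xs \<noteq> []" "ys \<noteq> []" by blast
    then show ?thesis
    proof cases
      case 1
      then show ?thesis using hd[of vs ys] vs xy by auto
    next
      case 2
      \<comment> \<open>Reversal turns the last vertex into the first, where \<open>hd\<close>
        applies.\<close>
      have "Q (rev vs)" using vs arcs_symmetric by (auto simp: Q_def set_vwalk_arcs_rev)
      then have "(v, w) \<in> set (vwalk_arcs (rev vs))" using hd[of "rev vs" "rev xs"] 2 xy by auto
      then show ?thesis by (simp add: set_vwalk_arcs_rev)
    next
      case 3
      then have arcs: "vwalk_arcs vs = vwalk_arcs xs @ (last xs, v) # (v, hd ys) # vwalk_arcs ys"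
        by (simp add: xy vwalk_arcs_append)
      have "last xs \<in> set xs" "hd ys \<in> set ys" using 3 by auto
      then have "last xs \<noteq> hd ys" "last xs \<notin> leaves G" "hd ys \<notin> leaves G"
        using vs by (auto simp: Q_def xy)
      moreover have "(v, last xs) \<in> parcs G" "(v, hd ys) \<in> parcs G"
        using vs arcs arcs_symmetric by (auto simp: Q_def)
      ultimately have "w = last xs \<or> w = hd ys" using two[of v "last xs" "hd ys" w] w by blast
      then show ?thesis using arcs by auto
    qed
  qed
  have vwalk_arcs_verts: "u \<in> set us \<and> v \<in> set us" if "(u, v) \<in> set (vwalk_arcs us)" for u v us
    using that by (induct us rule: vwalk_arcs.induct) auto
  have "set vs = ?N"
  proof (cases "?N = {}")
    \<comment> \<open>All vertices may be leaves, as for a single edge; the path is then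
      empty.\<close>
    case True
    then show ?thesis using vs by (auto simp: Q_def)
  next
    case False
    then obtain v where "v \<in> ?N" by blast
    then have "vs \<noteq> []" using max[of "[v]"] by (auto simp: Q_def)
    then show ?thesis
    proof (intro inner_verts_closed_eq[OF con])
      show "set vs \<subseteq> ?N" using vs by (simp add: Q_def)
      show "v \<in> set vs" if "u \<in> set vs" "(u, v) \<in> parcs G" "v \<notin> leaves G" for u v
        using step[OF that] vwalk_arcs_verts[of u v vs] vwalk_arcs_verts[of v u vs] by auto
    qed simp
  qed
  moreover have "arcs_ends (induce_subgraph (with_proj G) ?N) = ?E"
  proof -
    have "arcs_ends (induce_subgraph (with_proj G) ?N) = {(u, v) \<in> parcs G. u \<in> ?N \<and> v \<in> ?N}"
      by (auto simp: arcs_ends_conv)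
    also have "\<dots> = {(u, v) \<in> parcs G. u \<in> set vs \<and> v \<in> set vs}"
      by (simp only: \<open>set vs = ?N\<close>)
    also have "\<dots> = ?E"
    proof (intro equalityI subrelI)
      fix u v assume "(u, v) \<in> {(u, v) \<in> parcs G. u \<in> set vs \<and> v \<in> set vs}"
      then show "(u, v) \<in> ?E" using step[of u v] \<open>set vs = ?N\<close> by blast
    next
      fix u v assume "(u, v) \<in> ?E"
      then show "(u, v) \<in> {(u, v) \<in> parcs G. u \<in> set vs \<and> v \<in> set vs}"
        using vs arcs_symmetric vwalk_arcs_verts[of u v vs] vwalk_arcs_verts[of v u vs]
        by (auto simp: Q_def)
    qed
    finally show ?thesis .
  qed
  ultimately show ?thesis
    unfolding is_path_graph_def using vs by (intro exI[of _ vs]) (auto simp: Q_def)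
qed

lemma (in pair_graph) unicyclic_or_caterpillar:
  assumes con: "Digraph_Component.connected (with_proj G)"
    and two: "\<And>v a b c. (v, a) \<in> parcs G \<Longrightarrow> (v, b) \<in> parcs G \<Longrightarrow> (v, c) \<in> parcs G \<Longrightarrow>
      a \<notin> leaves G \<Longrightarrow> b \<notin> leaves G \<Longrightarrow> c \<notin> leaves G \<Longrightarrow> a = b \<or> b = c \<or> a = c"
  shows "unicyclic G \<or> caterpillar G"
proof (cases "ucycles G = {}")
  case True
  have "is_path_graph (induce_subgraph (with_proj G) (pverts G - leaves G))"
    by (rule inner_path_graph[OF con _ True]) (rule two)
  then show ?thesis using con True by (simp add: caterpillar_def utree_def)
next
  case False
  have "C = (\<lambda>(u, v). {u, v}) ` {(u, v) \<in> parcs G. u \<notin> leaves G \<and> v \<notin> leaves G}"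
    if "C \<in> ucycles G" for C
    by (rule ucycle_eq_inner_edges[OF con _ that]) (rule two)
  then have "\<exists>!C. C \<in> ucycles G" using False by blast
  then show ?thesis using con by (simp add: unicyclic_def)
qed

section \<open>Application to the diameter graph\<close>

lemma diameter_graph_three_neighbours:
  assumes "finite P"
    and arcs: "(v, a) \<in> parcs (diameter_graph P)" "(v, b) \<in> parcs (diameter_graph P)"
      "(v, c) \<in> parcs (diameter_graph P)"
    and inner: "a \<notin> leaves (diameter_graph P)" "b \<notin> leaves (diameter_graph P)"
      "c \<notin> leaves (diameter_graph P)"
  shows "a = b \<or> b = c \<or> a = c"
proof (rule ccontr)
  assume distinct: "\<not> ?thesis"
  define d where "d = diameter P"
  have le: "dist x y \<le> d" if "x \<in> P" "y \<in> P" for x y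
    unfolding d_def using assms(1) that by (intro diameter_bounded_bound finite_imp_bounded)
  have adj: "(x, y) \<in> parcs (diameter_graph P) \<longleftrightarrow> x \<in> P \<and> y \<in> P \<and> x \<noteq> y \<and> dist x y = d" for x y
    by (simp add: diameter_graph_def d_def)
  have P: "v \<in> P" "a \<in> P" "b \<in> P" "c \<in> P" using arcs by (auto simp: adj)
  have "\<exists>x\<in>{a, b, c}. \<forall>w. dist x w = d \<and> (\<forall>y\<in>{a, b, c}. dist y w \<le> d) \<longrightarrow> w = v"
    using arcs distinct le P by (intro one_of_three_neighbours_leaf) (auto simp: adj)
  then obtain x where x: "x \<in> {a, b, c}"
    "\<And>w. dist x w = d \<Longrightarrow> (\<forall>y\<in>{a, b, c}. dist y w \<le> d) \<Longrightarrow> w = v" by blast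
  have "w = v" if "(x, w) \<in> parcs (diameter_graph P)" for w
    using x(2)[of w] that le P by (auto simp: adj)
  moreover have "(x, v) \<in> parcs (diameter_graph P)"
    using x(1) arcs by (auto simp: adj dist_commute)
  moreover have "x \<in> pverts (diameter_graph P)" using x(1) P by (auto simp: diameter_graph_def)
  ultimately have "x \<in> leaves (diameter_graph P)" unfolding leaves_conv by blast
  then show False using x(1) inner by blast
qed

theorem theorem1p1:
  fixes n :: nat and z :: "nat \<Rightarrow> complex"
  assumes "n \<ge> 1"
    and "diameter (z ` {1..n}) \<le> 2"
    and "Delta n z = Delta_max n"
  shows "unicyclic (diameter_graph (z ` {1..n})) \<or> caterpillar (diameter_graph (z ` {1..n}))"
proof -
  let ?P = "z ` {1..n}"
  interpret pair_graph "diameter_graph ?P"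
    by (rule pair_graph_diameter_graph) simp
  have le: "dist x y \<le> diameter ?P" if "x \<in> ?P" "y \<in> ?P" for x y
    using that by (intro diameter_bounded_bound finite_imp_bounded) auto
  have bound: "cmod (z i - z j) \<le> 2" if "i \<in> {1..n}" "j \<in> {1..n}" for i j
    using le[of "z i" "z j"] that assms(2) by (auto simp: dist_norm)
  have "Digraph_Component.connected (with_proj (diameter_graph ?P))"
    unfolding connected_iff_closed
  proof (intro conjI allI impI)
    show "pverts (diameter_graph ?P) \<noteq> {}" using \<open>n \<ge> 1\<close> by (auto simp: diameter_graph_def)
    fix S assume S: "S \<subseteq> pverts (diameter_graph ?P)" "S \<noteq> {}"
      and closed: "\<forall>(u, v)\<in>parcs (diameter_graph ?P). u \<in> S \<longrightarrow> v \<in> S"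
    show "S = pverts (diameter_graph ?P)"
    proof (rule ccontr)
      assume ne: "S \<noteq> pverts (diameter_graph ?P)"
      define I where "I = {i \<in> {1..n}. z i \<in> S}"
      have "I \<noteq> {}" "I \<noteq> {1..n}" "I \<subseteq> {1..n}"
        using S ne by (auto simp: I_def diameter_graph_def)
      then obtain i j where ij: "i \<in> I" "j \<in> {1..n} - I" "cmod (z i - z j) = 2"
        using extremal_no_gap[OF bound assms(3)] by blast
      have "z i \<in> ?P" "z j \<in> ?P" using ij by (auto simp: I_def)
      \<comment> \<open>A pair at distance 2 in a set of diameter at most 2 realises the diameter,
        so it is an edge leaving \<open>S\<close>.\<close>
      then have "dist (z i) (z j) = diameter ?P"
        using le[of "z i" "z j"] assms(2) ij by (simp add: dist_norm)
      then have "(z i, z j) \<in> parcs (diameter_graph ?P)"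
        using ij \<open>z i \<in> ?P\<close> \<open>z j \<in> ?P\<close> by (auto simp: diameter_graph_def)
      then show False using closed ij by (auto simp: I_def)
    qed
  qed
  then show ?thesis
    by (rule unicyclic_or_caterpillar) (rule diameter_graph_three_neighbours[of ?P], auto)
qed

end
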